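(* Let $X$ be a nontrivial real Banach space, $C\subseteq X$ a nonempty set, and $F:C\times C\to\mathbb{R}$ a maximal monotone bifunction with $F(x,x)=0$ for all $x\in C$. Then $\overline{\operatorname{co}}\,h_F$ and the restriction of $h_F^{*\top}$ to $X\times X^*$ are representative functions of the operator $A^F$.
   Context: $X^*$ and $X^{**}$ are the topological dual and bidual of $X$, $X$ is identified with its canonical image in $X^{**}$, $\langle x^*,x\rangle$ is the value of $x^*\in X^*$ at $x\in X$, $\overline{\mathbb{R}}=\mathbb{R}\cup\{\pm\infty\}$, and $c:X\times X^*\to\mathbb{R}$, $c(x,x^* )=\langle x^*,x\rangle$. A bifunction $F:C\times C\to\mathbb{R}$ is monotone if $F(x,y)+F(y,x)\le 0$ for all $x,y\in C$. The operator $A^F:X\rightrightarrows X^*$ is defined by $A^F(x)=\{x^*\in X^*:F(x,y)-F(x,x)\ge\langle x^*,y-x\rangle\ \forall y\in C\}$ if $x\in C$ and $A^F(x)=\emptyset$ if $x\notin C$. The monotone bifunction $F$ is maximal monotone if $A^F$ is a maximal monotone operator, i.e. $A^F$ is monotone ($\langle y^*-x^*,y-x\rangle\ge 0$ whenever $x^*\in A^F(x)$, $y^*\in A^F(y)$) and its graph is not properly included in the graph of another monotone operator. The function $h_F:X\times X^*\to\overline{\mathbb{R}}$ is $h_F(x,x^* )=\sup_{y\in C}\{\langle x^*,y\rangle-F(x,y)\}+\delta_C(x)$, where $\delta_C$ is the indicator function of $C$ ($0$ on $C$, $+\infty$ off $C$). $\overline{\operatorname{co}}\,h_F$ is the largest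 convex (strongly) lower semicontinuous function on $X\times X^*$ that is everywhere $\le h_F$. The conjugate $h_F^*:X^*\times X^{**}\to\overline{\mathbb{R}}$ satisfies, for $(x,x^* )\in X\times X^*$, $h_F^*(x^*,x)=\sup_{(u,u^* )\in X\times X^*}\{\langle x^*,u\rangle+\langle u^*,x\rangle-h_F(u,u^* )\}$; its transpose is given by $h_F^{*\top}(x,x^* )=h_F^*(x^*,x)$. For a monotone operator $T:X\rightrightarrows X^*$ with graph $G(T)=\{(x,x^* ):x^*\in T(x)\}$, a representative function of $T$ is a convex and strongly lower semicontinuous function $h:X\times X^*\to\overline{\mathbb{R}}$ with $h\ge c$ and $G(T)\subseteq\{(x,x^* )\in X\times X^*:h(x,x^* )=c(x,x^* )\}$. *)

theory Defs
  imports "HOL-Analysis.Analysis"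
begin

type_synonym 'a dual = "'a \<Rightarrow>\<^sub>L real"

type_synonym 'a bidual = "'a dual dual"

definition canonical_embedding :: "'a::real_normed_vector \<Rightarrow> 'a bidual" where
  "canonical_embedding x = Blinfun (\<lambda>x'. blinfun_apply x' x)"

lemma canonical_embedding_apply [simp]:
  "blinfun_apply (canonical_embedding x) x' = blinfun_apply x' x"
  by (simp add: canonical_embedding_def bounded_linear_Blinfun_apply blinfun.bounded_linear_left)

definition coupling :: "'a::real_normed_vector \<times> 'a dual \<Rightarrow> real" where
  "coupling = (\<lambda>(x, x'). blinfun_apply x' x)"


subsection \<open>Monotone operators\<close>

definition graph_op :: "('a::real_normed_vector \<Rightarrow> 'a dual set) \<Rightarrow> ('a \<times> 'a dual) set" where
  "graph_op T = {(x, x'). x' \<in> T x}"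

definition monotone_op :: "('a::real_normed_vector \<Rightarrow> 'a dual set) \<Rightarrow> bool" where
  "monotone_op T \<longleftrightarrow>
    (\<forall>x y x' y'. x' \<in> T x \<longrightarrow> y' \<in> T y \<longrightarrow> blinfun_apply (y' - x') (y - x) \<ge> 0)"

definition maximal_monotone_op :: "('a::real_normed_vector \<Rightarrow> 'a dual set) \<Rightarrow> bool" where
  "maximal_monotone_op T \<longleftrightarrow>
    monotone_op T \<and> \<not> (\<exists>S. monotone_op S \<and> graph_op T \<subset> graph_op S)"


subsection \<open>Bifunctions\<close>

text \<open>A bifunction on \<open>C \<times> C\<close> is represented by a total function on the whole space.  Its values
  outside \<open>C \<times> C\<close> affect neither \<open>monotone_bifun\<close>, \<open>op_of_bifun\<close> nor, for nonempty \<open>C\<close>,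
  \<open>h_bifun\<close>.\<close>

definition monotone_bifun :: "'a set \<Rightarrow> ('a \<Rightarrow> 'a \<Rightarrow> real) \<Rightarrow> bool" where
  "monotone_bifun C F \<longleftrightarrow> (\<forall>x\<in>C. \<forall>y\<in>C. F x y + F y x \<le> 0)"

definition op_of_bifun ::
    "'a::real_normed_vector set \<Rightarrow> ('a \<Rightarrow> 'a \<Rightarrow> real) \<Rightarrow> 'a \<Rightarrow> 'a dual set" where
  "op_of_bifun C F x =
    (if x \<in> C then {x'. \<forall>y\<in>C. F x y - F x x \<ge> blinfun_apply x' (y - x)} else {})"

definition maximal_monotone_bifun ::
    "'a::real_normed_vector set \<Rightarrow> ('a \<Rightarrow> 'a \<Rightarrow> real) \<Rightarrow> bool" where
  "maximal_monotone_bifun C F \<longleftrightarrow>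
    monotone_bifun C F \<and> maximal_monotone_op (op_of_bifun C F)"

definition convex_indicator :: "'a set \<Rightarrow> 'a \<Rightarrow> ereal" where
  "convex_indicator C x = (if x \<in> C then 0 else \<infinity>)"

definition h_bifun ::
    "'a::real_normed_vector set \<Rightarrow> ('a \<Rightarrow> 'a \<Rightarrow> real) \<Rightarrow> 'a \<times> 'a dual \<Rightarrow> ereal" where
  "h_bifun C F = (\<lambda>(x, x').
    (SUP y\<in>C. ereal (blinfun_apply x' y - F x y)) + convex_indicator C x)"


subsection \<open>Convex lower semicontinuous functions\<close>

text \<open>Convexity is that of the epigraph in \<open>'z \<times> \<real>\<close>, so functions taking the value \<open>-\<infinity>\<close> are
  allowed and no convention for \<open>\<infinity> - \<infinity>\<close> is involved.\<close>

definition ereal_convex :: "('z::real_vector \<Rightarrow> ereal) \<Rightarrow> bool" where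
  "ereal_convex f \<longleftrightarrow> convex {(z, r::real). f z \<le> ereal r}"

definition lsc :: "('z::topological_space \<Rightarrow> ereal) \<Rightarrow> bool" where
  "lsc f \<longleftrightarrow> (\<forall>z. \<forall>a<f z. eventually (\<lambda>w. a < f w) (nhds z))"

definition closed_convex_hull_fun ::
    "('z::real_normed_vector \<Rightarrow> ereal) \<Rightarrow> 'z \<Rightarrow> ereal" where
  "closed_convex_hull_fun f = Sup {g. ereal_convex g \<and> lsc g \<and> g \<le> f}"

lemma closed_convex_hull_fun_greatest:
  fixes f :: "'z::real_normed_vector \<Rightarrow> ereal"
  shows "ereal_convex (closed_convex_hull_fun f)"
    and "lsc (closed_convex_hull_fun f)"
    and "closed_convex_hull_fun f \<le> f"
    and "\<lbrakk>ereal_convex g; lsc g; g \<le> f\<rbrakk> \<Longrightarrow> g \<le> closed_convex_hull_fun f"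
proof -
  let ?G = "{g. ereal_convex g \<and> lsc g \<and> g \<le> f}"
  have "{(z, r::real). Sup ?G z \<le> ereal r} = (\<Inter>g\<in>?G. {(z, r). g z \<le> ereal r})"
    by (auto simp: SUP_le_iff)
  moreover have "convex (\<Inter>g\<in>?G. {(z, r::real). g z \<le> ereal r})"
    by (rule convex_INT) (auto simp: ereal_convex_def)
  ultimately show "ereal_convex (closed_convex_hull_fun f)"
    by (simp add: ereal_convex_def closed_convex_hull_fun_def)
  show "lsc (closed_convex_hull_fun f)"
    unfolding lsc_def
  proof (intro allI impI)
    fix z a
    assume "a < closed_convex_hull_fun f z"
    then obtain g where g: "g \<in> ?G" "a < g z"
      by (auto simp: closed_convex_hull_fun_def less_SUP_iff)
    then have "eventually (\<lambda>w. a < g w) (nhds z)"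
      by (auto simp: lsc_def)
    then show "eventually (\<lambda>w. a < closed_convex_hull_fun f w) (nhds z)"
    proof (rule eventually_mono)
      fix w assume "a < g w"
      also have "g \<le> closed_convex_hull_fun f"
        unfolding closed_convex_hull_fun_def by (rule Sup_upper) (fact g(1))
      then have "g w \<le> closed_convex_hull_fun f w"
        by (rule le_funD)
      finally show "a < closed_convex_hull_fun f w" .
    qed
  qed
  show "closed_convex_hull_fun f \<le> f"
    unfolding closed_convex_hull_fun_def by (rule Sup_least) auto
  show "g \<le> closed_convex_hull_fun f" if "ereal_convex g" "lsc g" "g \<le> f"
    unfolding closed_convex_hull_fun_def by (rule Sup_upper) (use that in auto)
qed


subsection \<open>Conjugates and representative functions\<close>

text \<open>The dual of \<open>X \<times> X\<^sup>*\<close> is identified with \<open>X\<^sup>* \<times> X\<^sup>*\<^sup>*\<close>.\<close>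

definition conjugate ::
    "('a::real_normed_vector \<times> 'a dual \<Rightarrow> ereal) \<Rightarrow> 'a dual \<times> 'a bidual \<Rightarrow> ereal" where
  "conjugate h = (\<lambda>(x', x'').
    SUP (u, u')\<in>UNIV. ereal (blinfun_apply x' u + blinfun_apply x'' u') - h (u, u'))"

definition conjugate_transpose ::
    "('a::real_normed_vector \<times> 'a dual \<Rightarrow> ereal) \<Rightarrow> 'a bidual \<times> 'a dual \<Rightarrow> ereal" where
  "conjugate_transpose h = (\<lambda>(x'', x'). conjugate h (x', x''))"

definition restrict_to_predual ::
    "('a::real_normed_vector bidual \<times> 'a dual \<Rightarrow> ereal) \<Rightarrow> 'a \<times> 'a dual \<Rightarrow> ereal" where
  "restrict_to_predual k = (\<lambda>(x, x'). k (canonical_embedding x, x'))"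

definition representative_function ::
    "('a::real_normed_vector \<Rightarrow> 'a dual set) \<Rightarrow> ('a \<times> 'a dual \<Rightarrow> ereal) \<Rightarrow> bool" where
  "representative_function T h \<longleftrightarrow>
    ereal_convex h \<and> lsc h \<and> (\<forall>z. h z \<ge> ereal (coupling z)) \<and>
    graph_op T \<subseteq> {z. h z = ereal (coupling z)}"

end

(* The Fitzpatrick function \<phi> of T = A^F is convex and lower semicontinuous, and maximality of T
   gives c \<le> \<phi> with equality on the graph of T. Monotonicity of F gives \<phi> \<le> h_F, while
   h_F = c on the graph of T because F vanishes on the diagonal. Hence c \<le> \<phi> \<le> co h_F \<le> h_F
   settles the closed convex hull. The restricted conjugate dominates \<phi> (take the supremum over
   the graph only), and \<phi> \<le> h_F is exactly the statement that it is at most c on the graph. *)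
theory Submission
  imports Defs
begin

lemma ereal_convex_SUP:
  assumes "\<And>i. i \<in> I \<Longrightarrow> ereal_convex (f i)"
  shows "ereal_convex (\<lambda>z. SUP i\<in>I. f i z)"
proof -
  have "{(z, r::real). (SUP i\<in>I. f i z) \<le> ereal r} = (\<Inter>i\<in>I. {(z, r). f i z \<le> ereal r})"
    by (auto simp: SUP_le_iff)
  moreover have "convex (\<Inter>i\<in>I. {(z, r::real). f i z \<le> ereal r})"
    by (rule convex_INT) (use assms in \<open>auto simp: ereal_convex_def\<close>)
  ultimately show ?thesis
    by (simp add: ereal_convex_def)
qed

lemma lsc_SUP:
  assumes "\<And>i. i \<in> I \<Longrightarrow> lsc (f i)"
  shows "lsc (\<lambda>z. SUP i\<in>I. f i z)"
  unfolding lsc_def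
proof (intro allI impI)
  fix z a
  assume "a < (SUP i\<in>I. f i z)"
  then obtain i where i: "i \<in> I" "a < f i z"
    by (auto simp: less_SUP_iff)
  then have "eventually (\<lambda>w. a < f i w) (nhds z)"
    using assms by (auto simp: lsc_def)
  then show "eventually (\<lambda>w. a < (SUP i\<in>I. f i w)) (nhds z)"
    by (rule eventually_mono) (use i(1) in \<open>auto simp: less_SUP_iff\<close>)
qed

text \<open>The constant \<open>k\<close> is extended real because it will be a value of
  \<open>h_bifun\<close>, which can be infinite. For infinite \<open>k\<close> the function is
  constantly infinite, so its epigraph is empty or the whole space.\<close>

lemma ereal_convex_linear_minus:
  assumes "linear l"
  shows "ereal_convex (\<lambda>z. ereal (l z) - k)"
proof (cases k)
  case (real s)
  have "convex {(z, r). l z - s \<le> r}"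
  proof (rule convexI)
    fix p q and u v :: real
    assume p: "p \<in> {(z, r). l z - s \<le> r}" and q: "q \<in> {(z, r). l z - s \<le> r}"
      and uv: "0 \<le> u" "0 \<le> v" "u + v = 1"
    obtain z r z' r' where pq: "p = (z, r)" "q = (z', r')"
      by fastforce
    have le: "l z \<le> r + s" "l z' \<le> r' + s"
      using p q by (auto simp: pq)
    have "l (u *\<^sub>R z + v *\<^sub>R z') = u * l z + v * l z'"
      using assms by (simp add: linear_add linear_scale)
    also have "\<dots> \<le> u * (r + s) + v * (r' + s)"
      using le uv by (intro add_mono mult_left_mono) auto
    also have "\<dots> = u * r + v * r' + (u + v) * s"
      by (simp add: algebra_simps)
    finally show "u *\<^sub>R p + v *\<^sub>R q \<in> {(z, r). l z - s \<le> r}"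
      using uv by (simp add: pq)
  qed
  then show ?thesis
    using real by (simp add: ereal_convex_def)
qed (auto simp: ereal_convex_def case_prod_unfold)

lemma lsc_continuous_minus:
  fixes l :: "'z::t2_space \<Rightarrow> real"
  assumes "continuous_on UNIV l"
  shows "lsc (\<lambda>z. ereal (l z) - k)"
proof (cases k)
  case (real s)
  have "continuous_on UNIV (\<lambda>z. ereal (l z - s))"
    using assms by (intro continuous_intros)
  then have "isCont (\<lambda>z. ereal (l z - s)) z" for z
    unfolding continuous_on_eq_continuous_at[OF open_UNIV] by blast
  \<comment> \<open>Continuity speaks of the punctured filter \<open>at z\<close>,
    \<open>lsc\<close> of \<open>nhds z\<close>; the two limits agree because the limit is the value
    at \<open>z\<close> itself.\<close>
  then have "((\<lambda>z. ereal (l z - s)) \<longlongrightarrow> ereal (l z - s)) (nhds z)" for z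
    unfolding isCont_def tendsto_at_iff_tendsto_nhds[of "\<lambda>z. ereal (l z - s)"] .
  from order_tendstoD(1)[OF this] show ?thesis
    using real by (simp add: lsc_def)
qed (auto simp: lsc_def)

text \<open>The symmetric pairing of the product space with itself: \<open>(x, x')\<close> acts as
  the functional \<open>(x', canonical_embedding x)\<close>.\<close>

definition cross_pairing ::
    "'a::real_normed_vector \<times> 'a dual \<Rightarrow> 'a \<times> 'a dual \<Rightarrow> real" where
  "cross_pairing w z = blinfun_apply (snd z) (fst w) + blinfun_apply (snd w) (fst z)"

lemma bounded_linear_cross_pairing: "bounded_linear (cross_pairing w)"
  unfolding cross_pairing_def
  by (intro bounded_linear_add
      bounded_linear_compose[OF blinfun.bounded_linear_left bounded_linear_snd]
      bounded_linear_compose[OF blinfun.bounded_linear_right bounded_linear_fst])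

lemma
  fixes k :: "'a::real_normed_vector \<times> 'a dual \<Rightarrow> ereal"
  shows ereal_convex_SUP_cross_pairing:
      "ereal_convex (\<lambda>z. SUP w\<in>W. ereal (cross_pairing w z) - k w)"
    and lsc_SUP_cross_pairing:
      "lsc (\<lambda>z. SUP w\<in>W. ereal (cross_pairing w z) - k w)"
  by (intro ereal_convex_SUP ereal_convex_linear_minus lsc_SUP lsc_continuous_minus
      bounded_linear.linear bounded_linear_cross_pairing linear_continuous_on)+

text \<open>On embedded points the bidual part of the pairing is evaluation, so the restriction is a
  supremum of continuous affine functions of \<open>z\<close>.\<close>

lemma restricted_conjugate_eq:
  "restrict_to_predual (conjugate_transpose h) =
    (\<lambda>z. SUP w. ereal (cross_pairing w z) - h w)"
  by (auto simp: restrict_to_predual_def conjugate_transpose_def conjugate_def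
      cross_pairing_def case_prod_unfold)

text \<open>Equivalently, the restricted transposed conjugate of the coupling extended by
  \<open>\<infinity>\<close> off the graph.\<close>

definition fitzpatrick ::
    "('a::real_normed_vector \<Rightarrow> 'a dual set) \<Rightarrow> 'a \<times> 'a dual \<Rightarrow> ereal" where
  "fitzpatrick T z = (SUP w\<in>graph_op T. ereal (cross_pairing w z) - ereal (coupling w))"

lemma ereal_convex_fitzpatrick: "ereal_convex (fitzpatrick T)"
  and lsc_fitzpatrick: "lsc (fitzpatrick T)"
  unfolding fitzpatrick_def by (rule ereal_convex_SUP_cross_pairing lsc_SUP_cross_pairing)+

text \<open>Otherwise adjoining \<open>(x, x')\<close> to the graph would give a proper monotone
  extension.\<close>

lemma maximal_monotone_op_memI:
  assumes max: "maximal_monotone_op T"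
    and rel: "\<And>u u'. u' \<in> T u \<Longrightarrow> 0 \<le> blinfun_apply (x' - u') (x - u)"
  shows "x' \<in> T x"
proof (rule ccontr)
  assume notin: "x' \<notin> T x"
  define S where "S = T(x := insert x' (T x))"
  have rel': "0 \<le> blinfun_apply (u' - x') (u - x)" if "u' \<in> T u" for u u'
    using rel[OF that] by (simp add: blinfun.diff_left blinfun.diff_right)
  have mono: "monotone_op T"
    using max by (simp add: maximal_monotone_op_def)
  have "monotone_op S"
    using mono rel rel' by (fastforce simp: monotone_op_def S_def split: if_splits)
  moreover have "graph_op T \<subset> graph_op S"
    using notin by (auto simp: graph_op_def S_def split: if_splits)
  ultimately show False
    using max by (auto simp: maximal_monotone_op_def)
qed

text \<open>For \<open>w = (u, u')\<close>,
  \<open>coupling z - (cross_pairing w z - coupling w)\<close> equals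
  \<open>(x' - u') (x - u)\<close>. It vanishes for \<open>w = z\<close>; if \<open>z\<close> lies
  off the graph, maximality supplies a \<open>w\<close> in the graph making it negative.\<close>

lemma coupling_le_fitzpatrick:
  assumes "maximal_monotone_op T"
  shows "ereal (coupling z) \<le> fitzpatrick T z"
proof -
  obtain x x' where z: "z = (x, x')"
    by fastforce
  have "\<exists>w\<in>graph_op T. coupling z \<le> cross_pairing w z - coupling w"
  proof (cases "x' \<in> T x")
    case True
    then show ?thesis
      by (intro bexI[of _ z]) (auto simp: z graph_op_def cross_pairing_def coupling_def)
  next
    case False
    then obtain u u' where u: "u' \<in> T u" and "blinfun_apply (x' - u') (x - u) < 0"
      using maximal_monotone_op_memI[OF assms] by (meson not_le)
    then have "coupling z \<le> cross_pairing (u, u') z - coupling (u, u')"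
      by (simp add: z coupling_def cross_pairing_def blinfun.diff_left blinfun.diff_right)
    then show ?thesis
      using u by (auto simp: graph_op_def)
  qed
  then show ?thesis
    unfolding fitzpatrick_def by (auto intro: SUP_upper2)
qed

text \<open>The affine function indexed by \<open>(u, u')\<close> in the graph lies below the single
  term \<open>y = u\<close> of the supremum in \<open>h_bifun\<close>, because
  \<open>u' (x - u) \<le> F u x \<le> - F x u\<close>.\<close>

lemma fitzpatrick_le_h_bifun:
  assumes mono: "monotone_bifun C F" and diag: "\<forall>x\<in>C. F x x = 0"
  shows "fitzpatrick (op_of_bifun C F) z \<le> h_bifun C F z"
proof -
  obtain x x' where z: "z = (x, x')"
    by fastforce
  show ?thesis
  proof (cases "x \<in> C")
    case True
    have "ereal (cross_pairing w z) - ereal (coupling w)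
        \<le> (SUP y\<in>C. ereal (blinfun_apply x' y - F x y))"
      if "w \<in> graph_op (op_of_bifun C F)" for w
    proof -
      obtain u u' where w: "w = (u, u')"
        by fastforce
      have u: "u \<in> C" "u' \<in> op_of_bifun C F u"
        using that by (auto simp: w graph_op_def op_of_bifun_def split: if_splits)
      then have "blinfun_apply u' (x - u) \<le> F u x"
        using True diag by (auto simp: op_of_bifun_def)
      also have "\<dots> \<le> - F x u"
        using mono u(1) True by (fastforce simp: monotone_bifun_def)
      finally have "cross_pairing w z - coupling w \<le> blinfun_apply x' u - F x u"
        by (simp add: w z cross_pairing_def coupling_def blinfun.diff_right)
      then show ?thesis
        using u(1) by (auto intro: SUP_upper2)
    qed
    then show ?thesis
      using True by (auto simp: z h_bifun_def convex_indicator_def fitzpatrick_def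
          intro: SUP_least)
  qed (simp add: z h_bifun_def convex_indicator_def)
qed

text \<open>With \<open>F x x = 0\<close>, membership in the operator bounds each term
  \<open>x' y - F x y\<close> by \<open>x' x\<close>.\<close>

lemma h_bifun_le_coupling:
  assumes diag: "\<forall>x\<in>C. F x x = 0" and z: "z \<in> graph_op (op_of_bifun C F)"
  shows "h_bifun C F z \<le> ereal (coupling z)"
proof -
  obtain x x' where zx: "z = (x, x')"
    by fastforce
  have x: "x \<in> C" and "\<forall>y\<in>C. blinfun_apply x' (y - x) \<le> F x y"
    using z diag by (auto simp: zx graph_op_def op_of_bifun_def split: if_splits)
  then have "\<forall>y\<in>C. blinfun_apply x' y - F x y \<le> blinfun_apply x' x"
    by (auto simp: blinfun.diff_right algebra_simps)
  then show ?thesis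
    using x by (auto simp: zx h_bifun_def convex_indicator_def coupling_def intro: SUP_least)
qed

text \<open>The bifunction enters only through two bounds on \<open>h\<close>; the Fitzpatrick
  function is one of the minorants over which the hull is the supremum.\<close>

lemma representative_function_closed_convex_hull:
  assumes "maximal_monotone_op T" and "fitzpatrick T \<le> h"
    and "\<And>z. z \<in> graph_op T \<Longrightarrow> h z \<le> ereal (coupling z)"
  shows "representative_function T (closed_convex_hull_fun h)"
proof -
  have "fitzpatrick T \<le> closed_convex_hull_fun h"
    by (intro closed_convex_hull_fun_greatest(4) ereal_convex_fitzpatrick lsc_fitzpatrick assms(2))
  then have ge: "ereal (coupling z) \<le> closed_convex_hull_fun h z" for z
    using coupling_le_fitzpatrick[OF assms(1), of z] by (auto dest: le_funD intro: order_trans)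
  have "closed_convex_hull_fun h z \<le> ereal (coupling z)" if "z \<in> graph_op T" for z
    using assms(3)[OF that] closed_convex_hull_fun_greatest(3)[of h]
    by (auto dest: le_funD intro: order_trans)
  with ge show ?thesis
    by (auto simp: representative_function_def closed_convex_hull_fun_greatest(1,2)
        intro: antisym)
qed

lemma representative_function_restricted_conjugate:
  assumes "maximal_monotone_op T" and "fitzpatrick T \<le> h"
    and "\<And>z. z \<in> graph_op T \<Longrightarrow> h z \<le> ereal (coupling z)"
  shows "representative_function T (restrict_to_predual (conjugate_transpose h))"
proof -
  let ?k = "\<lambda>z. SUP w. ereal (cross_pairing w z) - h w"
  have le: "fitzpatrick T z \<le> ?k z" for z
    unfolding fitzpatrick_def
    by (rule SUP_mono) (blast intro: ereal_minus_mono assms(3))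
  have ge: "ereal (coupling z) \<le> ?k z" for z
    using coupling_le_fitzpatrick[OF assms(1)] le by (rule order_trans)
  \<comment> \<open>Symmetry of the pairing exchanges roles: \<open>fitzpatrick T \<le> h\<close> is
    read at an arbitrary \<open>w\<close>, keeping only the term indexed by
    \<open>z\<close>.\<close>
  have "?k z \<le> ereal (coupling z)" if z: "z \<in> graph_op T" for z
  proof (rule SUP_least)
    fix w
    have "ereal (cross_pairing z w) - ereal (coupling z) \<le> fitzpatrick T w"
      unfolding fitzpatrick_def by (rule SUP_upper[OF z])
    also have "\<dots> \<le> h w"
      using assms(2) by (rule le_funD)
    finally have "ereal (cross_pairing z w - coupling z) \<le> h w"
      by simp
    moreover have "cross_pairing z w = cross_pairing w z"
      by (simp add: cross_pairing_def)
    ultimately show "ereal (cross_pairing w z) - h w \<le> ereal (coupling z)"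
      \<comment> \<open>The real lower bound excludes \<open>h w = -\<infinity>\<close>, and
        \<open>h w = \<infinity>\<close> makes the left side \<open>-\<infinity>\<close>.\<close>
      by (cases "h w") auto
  qed
  with ge show ?thesis
    unfolding restricted_conjugate_eq representative_function_def
    by (auto intro: antisym ereal_convex_SUP_cross_pairing lsc_SUP_cross_pairing)
qed

theorem theorem15:
  fixes C :: "'a::banach set" and F :: "'a \<Rightarrow> 'a \<Rightarrow> real"
  assumes "\<exists>x::'a. x \<noteq> 0"
    and "C \<noteq> {}"
    and "maximal_monotone_bifun C F"
    and "\<forall>x\<in>C. F x x = 0"
  shows "representative_function (op_of_bifun C F) (closed_convex_hull_fun (h_bifun C F)) \<and>
    representative_function (op_of_bifun C F)
      (restrict_to_predual (conjugate_transpose (h_bifun C F)))"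
proof -
  have mono: "monotone_bifun C F" and max: "maximal_monotone_op (op_of_bifun C F)"
    using assms(3) by (auto simp: maximal_monotone_bifun_def)
  have "fitzpatrick (op_of_bifun C F) \<le> h_bifun C F"
    using fitzpatrick_le_h_bifun[OF mono assms(4)] by (rule le_funI)
  moreover have "h_bifun C F z \<le> ereal (coupling z)" if "z \<in> graph_op (op_of_bifun C F)" for z
    using assms(4) that by (rule h_bifun_le_coupling)
  ultimately show ?thesis
    using max by (intro conjI representative_function_closed_convex_hull
        representative_function_restricted_conjugate)
qed

end
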